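(* Let the positive integer $n$ be fixed. Then $\displaystyle\lim_{k\to\infty}P_{k,n}^{(0)}=1$.
   Context: $\mathcal{IS}_n$ is the symmetric inverse semigroup of all partial injective maps from $\{1,\dots,n\}$ to itself, under composition of partial maps; the empty map, denoted $0$, is its zero element and its only element of rank $0$ (the rank of $\alpha$ is $|\operatorname{dom}(\alpha)|$). Let $x_1,\dots,x_k$ be chosen independently and uniformly at random from $\mathcal{IS}_n$. $P_{k,n}^{(0)}$ is the probability that the product $x_1x_2\cdots x_k$ equals $0$. *)

theory Defs
  imports "HOL-Probability.Probability"
begin

definition sym_inv_semigroup :: "nat \<Rightarrow> (nat \<rightharpoonup> nat) set" where
  "sym_inv_semigroup n = {f. dom f \<subseteq> {1..n} \<and> ran f \<subseteq> {1..n} \<and> inj_on f (dom f)}"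

(* map_comp applies its right factor first. The empty product is the identity of the semigroup. *)
definition sis_prod :: "nat \<Rightarrow> (nat \<rightharpoonup> nat) list \<Rightarrow> (nat \<rightharpoonup> nat)" where
  "sis_prod n xs = foldr (\<circ>\<^sub>m) xs (Some |` {1..n})"

(* pmf_of_set is the uniform distribution only on finite nonempty sets; both conditions are
   proved below. replicate_pmf draws its k entries independently. *)
definition prob_zero_prod :: "nat \<Rightarrow> nat \<Rightarrow> real" where
  "prob_zero_prod k n =
     measure_pmf.prob (replicate_pmf k (pmf_of_set (sym_inv_semigroup n)))
       {xs. sis_prod n xs = Map.empty}"

lemma finite_sym_inv_semigroup: "finite (sym_inv_semigroup n)"
proof (rule finite_subset)
  show "sym_inv_semigroup n \<subseteq>
      (\<Union>D\<in>Pow {1..n}. {f. dom f = D \<and> ran f \<subseteq> {1..n}})"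
    by (auto simp: sym_inv_semigroup_def)
  show "finite (\<Union>D\<in>Pow {1..n}. {f::nat \<rightharpoonup> nat. dom f = D \<and> ran f \<subseteq> {1..n}})"
    by (intro finite_UN_I finite_set_of_finite_maps) (auto intro: finite_subset)
qed

lemma empty_in_sym_inv_semigroup: "Map.empty \<in> sym_inv_semigroup n"
  by (simp add: sym_inv_semigroup_def)

lemma sym_inv_semigroup_nonempty: "sym_inv_semigroup n \<noteq> {}"
  using empty_in_sym_inv_semigroup by blast

lemma id_in_sym_inv_semigroup: "Some |` {1..n} \<in> sym_inv_semigroup n"
  by (auto simp: sym_inv_semigroup_def inj_on_def ran_def restrict_map_def split: if_splits)

lemma map_comp_in_sym_inv_semigroup:
  assumes "f \<in> sym_inv_semigroup n" "g \<in> sym_inv_semigroup n"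
  shows "f \<circ>\<^sub>m g \<in> sym_inv_semigroup n"
proof -
  have df: "dom f \<subseteq> {1..n}" and rf: "ran f \<subseteq> {1..n}" and jf: "inj_on f (dom f)"
    and dg: "dom g \<subseteq> {1..n}" and jg: "inj_on g (dom g)"
    using assms by (auto simp: sym_inv_semigroup_def)
  have "dom (f \<circ>\<^sub>m g) \<subseteq> dom g" "ran (f \<circ>\<^sub>m g) \<subseteq> ran f"
    by (auto simp: map_comp_def dom_def ran_def split: option.splits)
  moreover have "inj_on (f \<circ>\<^sub>m g) (dom (f \<circ>\<^sub>m g))"
  proof (rule inj_onI)
    fix x y assume x: "x \<in> dom (f \<circ>\<^sub>m g)" and "y \<in> dom (f \<circ>\<^sub>m g)"
      and eq: "(f \<circ>\<^sub>m g) x = (f \<circ>\<^sub>m g) y"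
    then obtain a b c where "g x = Some a" "g y = Some b" "f a = Some c" "f b = Some c"
      by (auto simp: map_comp_def split: option.splits)
    moreover from this have "a = b" using jf by (auto simp: inj_on_def dom_def)
    ultimately show "x = y" using jg by (auto simp: inj_on_def dom_def)
  qed
  ultimately show ?thesis using dg rf by (auto simp: sym_inv_semigroup_def)
qed

lemma sis_prod_in_sym_inv_semigroup:
  "set xs \<subseteq> sym_inv_semigroup n \<Longrightarrow> sis_prod n xs \<in> sym_inv_semigroup n"
  by (induction xs)
    (simp_all add: sis_prod_def id_in_sym_inv_semigroup map_comp_in_sym_inv_semigroup del: One_nat_def)

lemma sis_prod_singleton:
  assumes "f \<in> sym_inv_semigroup n"
  shows "sis_prod n [f] = f"
  using assms
  by (auto simp: sis_prod_def sym_inv_semigroup_def map_comp_def restrict_map_def fun_eq_iff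
      dom_def subset_iff split: if_splits) (metis not_None_eq)+

end

theory Submission
  imports Defs
begin

text \<open>
  The zero map is absorbing, so a product vanishes as soon as one of its factors does. Each
  factor is zero with the same positive probability, namely the reciprocal of the (finite) size
  of the semigroup, and the factors are independent. Hence the product is nonzero with
  probability at most \<open>q ^ k\<close> for a constant \<open>q < 1\<close>, and this bound tends to zero.
\<close>

lemma sis_prod_eq_empty:
  assumes "Map.empty \<in> set xs"
  shows "sis_prod n xs = Map.empty"
  using assms by (induction xs) (auto simp: sis_prod_def)

text \<open>
  Restricting both sides to the supports, which are countable, does not change any of the
  probabilities and reduces the claim to countable sets.
\<close>

lemma prob_pair_pmf_Times:
  "measure_pmf.prob (pair_pmf p q) (A \<times> B) = measure_pmf.prob p A * measure_pmf.prob q B"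
proof -
  have "measure_pmf.prob (pair_pmf p q) (A \<times> B) =
      measure_pmf.prob (pair_pmf p q) ((A \<inter> set_pmf p) \<times> (B \<inter> set_pmf q))"
    using measure_Int_set_pmf[of "pair_pmf p q" "A \<times> B"] by (simp add: Times_Int_Times)
  also have "\<dots> = measure_pmf.prob p (A \<inter> set_pmf p) * measure_pmf.prob q (B \<inter> set_pmf q)"
    by (rule measure_pmf_prob_product) (simp_all add: countable_Int2)
  finally show ?thesis
    by (simp add: measure_Int_set_pmf)
qed

lemma prob_replicate_pmf_subset:
  "measure_pmf.prob (replicate_pmf k p) {xs. set xs \<subseteq> B} = measure_pmf.prob p B ^ k"
proof (induction k)
  case 0
  show ?case by simp
next
  case (Suc k)
  have "replicate_pmf (Suc k) p = map_pmf (\<lambda>(x, xs). x # xs) (pair_pmf p (replicate_pmf k p))"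
    by (simp add: pair_pmf_def map_bind_pmf bind_return_pmf)
  moreover have "(\<lambda>(x, xs). x # xs) -` {xs. set xs \<subseteq> B} = B \<times> {xs. set xs \<subseteq> B}"
    by auto
  ultimately have "measure_pmf.prob (replicate_pmf (Suc k) p) {xs. set xs \<subseteq> B} =
      measure_pmf.prob (pair_pmf p (replicate_pmf k p)) (B \<times> {xs. set xs \<subseteq> B})"
    by (simp del: replicate_pmf.simps)
  also have "\<dots> = measure_pmf.prob p B * measure_pmf.prob (replicate_pmf k p) {xs. set xs \<subseteq> B}"
    by (rule prob_pair_pmf_Times)
  finally show ?case
    by (simp add: Suc.IH del: replicate_pmf.simps)
qed

theorem corollary8:
  fixes n :: nat
  assumes "n \<ge> 1"
  shows "(\<lambda>k. prob_zero_prod k n) \<longlonglongrightarrow> 1"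
proof (rule tendsto_sandwich)
  let ?p = "pmf_of_set (sym_inv_semigroup n)"
  let ?q = "measure_pmf.prob ?p (- {Map.empty})"
  have "measure_pmf.prob ?p {Map.empty} > 0"
    by (simp add: measure_pmf_single finite_sym_inv_semigroup sym_inv_semigroup_nonempty
        empty_in_sym_inv_semigroup card_gt_0_iff)
  moreover have "?q = 1 - measure_pmf.prob ?p {Map.empty}"
    using measure_pmf.prob_compl[of "{Map.empty}" ?p] by (simp add: Compl_eq_Diff_UNIV)
  ultimately have "?q < 1"
    by simp
  then have "(\<lambda>k. ?q ^ k) \<longlonglongrightarrow> 0"
    by (intro LIMSEQ_realpow_zero) auto
  then show "(\<lambda>k. 1 - ?q ^ k) \<longlonglongrightarrow> 1"
    using tendsto_diff[OF tendsto_const, of "\<lambda>k. ?q ^ k" 0 sequentially 1] by simp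
  show "\<forall>\<^sub>F k in sequentially. 1 - ?q ^ k \<le> prob_zero_prod k n"
  proof (rule always_eventually, rule allI)
    fix k
    let ?Z = "{xs. sis_prod n xs = Map.empty}"
    let ?r = "replicate_pmf k ?p"
    have "1 - prob_zero_prod k n = measure_pmf.prob ?r (- ?Z)"
      using measure_pmf.prob_compl[of ?Z ?r]
      by (simp add: prob_zero_prod_def Compl_eq_Diff_UNIV)
    also have "\<dots> \<le> measure_pmf.prob ?r {xs. set xs \<subseteq> - {Map.empty}}"
      by (rule measure_pmf.finite_measure_mono) (auto intro: sis_prod_eq_empty)
    also have "\<dots> = ?q ^ k"
      by (rule prob_replicate_pmf_subset)
    finally show "1 - ?q ^ k \<le> prob_zero_prod k n"
      by simp
  qed
  show "\<forall>\<^sub>F k in sequentially. prob_zero_prod k n \<le> 1"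
    by (simp add: prob_zero_prod_def)
qed (rule tendsto_const)

end
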